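(* Let $\mathbf A$ be a finite relational structure such that the variety $\mathcal V(\mathrm{Alg}(\mathbf A))$ is not congruence modular. Then $\exists\mathrm{CSP}(\mathbf A)$ is not sublinear-query testable with one-sided error: there is $\epsilon>0$ such that every one-sided-error $\epsilon$-tester for $\exists\mathrm{CSP}(\mathbf A)$ makes a number of queries linear in the number of free variables on some instances.
   Context: $\mathrm{Alg}(\mathbf A)=(A;\mathrm{Pol}(\mathbf A))$ is the algebra of all polymorphisms of $\mathbf A$ (operations preserving every relation of $\mathbf A$ under coordinatewise application); $\mathcal V(\cdot)$ is the generated variety; a variety is congruence modular if the congruence lattice of each of its members satisfies the modular law. $\exists\mathrm{CSP}(\mathbf A)$: instances $(V,V^\exists,\mathcal C,w)$ with free variables $V$, existentially quantified variables $V^\exists$, constraints $\langle(x_1,\dots,x_k),R\rangle$ with $R$ a relation of $\mathbf A$, and weights $w:V\to[0,1]$ summing to 1; $f:V\to A$ is satisfying if it extends to an assignment of $V\cup V^\exists$ satisfying all constraints. $f$ is $\epsilon$-far if for every satisfying $g$, $\sum_{x\in V:f(x)\ne g(x)}w(x)>\epsilon$. A one-sided $\epsilon$-tester is given the instance and $\epsilon$, queries values of $f$, always accepts satisfying $f$, and rejects $\epsilon$-far $f$ with probability $\ge 2/3$. *)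

theory Defs
  imports "HOL-Probability.Probability"
begin

definition rel_structure :: "(nat \<times> ('a::finite) list set) set \<Rightarrow> bool" where
  "rel_structure Rels \<longleftrightarrow> finite Rels \<and> (\<forall>(k, R) \<in> Rels. \<forall>xs \<in> R. length xs = k)"

definition preserves :: "nat \<Rightarrow> ('a list \<Rightarrow> 'a) \<Rightarrow> nat \<Rightarrow> 'a list set \<Rightarrow> bool" where
  "preserves n f k R \<longleftrightarrow>
     (\<forall>rs. length rs = n \<longrightarrow> set rs \<subseteq> R \<longrightarrow>
        map (\<lambda>j. f (map (\<lambda>r. r ! j) rs)) [0..<k] \<in> R)"

text \<open>Polymorphisms of A, used as the operation symbols of Alg(A). An n-ary operation
 is a function on lists, normalised to be undefined on lists of length other than n.\<close>
definition Pol :: "(nat \<times> ('a::finite) list set) set \<Rightarrow> (nat \<times> ('a list \<Rightarrow> 'a)) set" where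
  "Pol Rels = {(n, f). n \<ge> 1 \<and> (\<forall>xs. length xs \<noteq> n \<longrightarrow> f xs = undefined)
                  \<and> (\<forall>(k, R) \<in> Rels. preserves n f k R)}"

type_synonym ('a, 'b) alg = "'b set \<times> ((nat \<times> ('a list \<Rightarrow> 'a)) \<Rightarrow> 'b list \<Rightarrow> 'b)"

definition subuniverse :: "(nat \<times> ('a::finite) list set) set \<Rightarrow> 'b set \<Rightarrow> ('a, 'b) alg \<Rightarrow> bool" where
  "subuniverse Rels C B \<longleftrightarrow> C \<subseteq> fst B \<and>
     (\<forall>s \<in> Pol Rels. \<forall>xs. length xs = fst s \<longrightarrow> set xs \<subseteq> C \<longrightarrow> snd B s xs \<in> C)"

definition is_algebra :: "(nat \<times> ('a::finite) list set) set \<Rightarrow> ('a, 'b) alg \<Rightarrow> bool" where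
  "is_algebra Rels B \<longleftrightarrow> subuniverse Rels (fst B) B"

definition power_alg :: "'i set \<Rightarrow> ('a::finite, 'i \<Rightarrow> 'a) alg" where
  "power_alg I = ({x. \<forall>i. i \<notin> I \<longrightarrow> x i = undefined},
     (\<lambda>s xs. (\<lambda>i. if i \<in> I then snd s (map (\<lambda>x. x i) xs) else undefined)))"

definition surj_hom :: "(nat \<times> ('a::finite) list set) set \<Rightarrow> ('c \<Rightarrow> 'b)
     \<Rightarrow> 'c set \<Rightarrow> ('a, 'c) alg \<Rightarrow> ('a, 'b) alg \<Rightarrow> bool" where
  "surj_hom Rels h C A B \<longleftrightarrow> h ` C = fst B \<and>
     (\<forall>s \<in> Pol Rels. \<forall>xs. length xs = fst s \<longrightarrow> set xs \<subseteq> C \<longrightarrow>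
        h (snd A s xs) = snd B s (map h xs))"

text \<open>B is in HSP(Alg(A)) = V(Alg(A)), witnessed with an index set I (of arbitrary type):
 B is a homomorphic image of a subalgebra of the power Alg(A)^I.\<close>
definition in_variety :: "(nat \<times> ('a::finite) list set) set \<Rightarrow> 'i set \<Rightarrow> ('a, 'b) alg \<Rightarrow> bool" where
  "in_variety Rels I B \<longleftrightarrow> is_algebra Rels B \<and>
     (\<exists>C h. subuniverse Rels C (power_alg I) \<and> surj_hom Rels h C (power_alg I) B)"

definition congruence :: "(nat \<times> ('a::finite) list set) set \<Rightarrow> ('a, 'b) alg \<Rightarrow> ('b \<times> 'b) set \<Rightarrow> bool" where
  "congruence Rels B \<theta> \<longleftrightarrow> equiv (fst B) \<theta> \<and>
     (\<forall>s \<in> Pol Rels. \<forall>xs ys. length xs = fst s \<longrightarrow> length ys = fst s \<longrightarrow>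
        set xs \<subseteq> fst B \<longrightarrow> set ys \<subseteq> fst B \<longrightarrow> list_all2 (\<lambda>x y. (x, y) \<in> \<theta>) xs ys \<longrightarrow>
        (snd B s xs, snd B s ys) \<in> \<theta>)"

definition con_join :: "(nat \<times> ('a::finite) list set) set \<Rightarrow> ('a, 'b) alg \<Rightarrow> ('b \<times> 'b) set \<Rightarrow> ('b \<times> 'b) set \<Rightarrow> ('b \<times> 'b) set" where
  "con_join Rels B \<alpha> \<beta> = \<Inter> {\<theta>. congruence Rels B \<theta> \<and> \<alpha> \<union> \<beta> \<subseteq> \<theta>}"

definition con_modular :: "(nat \<times> ('a::finite) list set) set \<Rightarrow> ('a, 'b) alg \<Rightarrow> bool" where
  "con_modular Rels B \<longleftrightarrow>
     (\<forall>\<alpha> \<beta> \<gamma>. congruence Rels B \<alpha> \<longrightarrow> congruence Rels B \<beta> \<longrightarrow> congruence Rels B \<gamma> \<longrightarrow>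
        \<alpha> \<subseteq> \<gamma> \<longrightarrow> con_join Rels B \<alpha> (\<beta> \<inter> \<gamma>) = con_join Rels B \<alpha> \<beta> \<inter> \<gamma>)"

record 'a csp_inst =
  fvars :: "nat set"
  evars :: "nat set"
  constraints :: "(nat list \<times> (nat \<times> 'a list set)) list"
  weight :: "nat \<Rightarrow> real"

definition wf_inst :: "(nat \<times> ('a::finite) list set) set \<Rightarrow> 'a csp_inst \<Rightarrow> bool" where
  "wf_inst Rels P \<longleftrightarrow> finite (fvars P) \<and> finite (evars P) \<and> fvars P \<inter> evars P = {} \<and>
     (\<forall>(xs, (k, R)) \<in> set (constraints P). (k, R) \<in> Rels \<and> length xs = k \<and>
         set xs \<subseteq> fvars P \<union> evars P) \<and>
     (\<forall>x \<in> fvars P. 0 \<le> weight P x \<and> weight P x \<le> 1) \<and>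
     (\<Sum>x \<in> fvars P. weight P x) = 1"

definition satisfying :: "'a csp_inst \<Rightarrow> (nat \<Rightarrow> 'a) \<Rightarrow> bool" where
  "satisfying P f \<longleftrightarrow> (\<exists>g. (\<forall>x \<in> fvars P. g x = f x) \<and>
      (\<forall>(xs, (k, R)) \<in> set (constraints P). map g xs \<in> R))"

definition wdist :: "'a csp_inst \<Rightarrow> (nat \<Rightarrow> 'a) \<Rightarrow> (nat \<Rightarrow> 'a) \<Rightarrow> real" where
  "wdist P f g = (\<Sum>x \<in> {x \<in> fvars P. f x \<noteq> g x}. weight P x)"

definition eps_far :: "'a csp_inst \<Rightarrow> real \<Rightarrow> (nat \<Rightarrow> 'a) \<Rightarrow> bool" where
  "eps_far P eps f \<longleftrightarrow> (\<forall>g. satisfying P g \<longrightarrow> wdist P f g > eps)"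

text \<open>A deterministic adaptive query algorithm: a decision tree that queries values of f
 at variables and finally accepts (True) or rejects (False). A randomized tester is a
 probability distribution over such trees, chosen depending on the instance.\<close>
datatype ('v, 'a) dtree = Leaf bool | Query 'v "'a \<Rightarrow> ('v, 'a) dtree"

primrec run :: "('v, 'a) dtree \<Rightarrow> ('v \<Rightarrow> 'a) \<Rightarrow> bool" where
  "run (Leaf b) f = b"
| "run (Query x t) f = run (t (f x)) f"

primrec nqueries :: "('v, 'a) dtree \<Rightarrow> ('v \<Rightarrow> 'a) \<Rightarrow> nat" where
  "nqueries (Leaf b) f = 0"
| "nqueries (Query x t) f = Suc (nqueries (t (f x)) f)"

definition one_sided_tester :: "(nat \<times> ('a::finite) list set) set \<Rightarrow> real
     \<Rightarrow> ('a csp_inst \<Rightarrow> (nat, 'a) dtree pmf) \<Rightarrow> bool" where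
  "one_sided_tester Rels eps T \<longleftrightarrow>
     (\<forall>P. wf_inst Rels P \<longrightarrow>
        (\<forall>f. satisfying P f \<longrightarrow> measure_pmf.prob (T P) {t. run t f} = 1) \<and>
        (\<forall>f. eps_far P eps f \<longrightarrow> measure_pmf.prob (T P) {t. \<not> run t f} \<ge> 2/3))"

end

(*
  Day's theorem turns failure of modularity into a finite obstruction: there is no sequence of
  quaternary polymorphisms f with f(x,y,y,x) = x that leads from the first to the fourth projection
  such that consecutive members agree on all (x,x,u,u) or on all (x,y,y,u).

  Quaternary polymorphisms are the solutions of the indicator instance with one variable per element
  of A^4, so a chain p_0, q_0, p_1, q_1, ... of such instances can be glued along shared variables:
  p_j and q_j share the values at (x,y,y,u), q_j and p_(j+1) share the values at (x,x,u,u), and the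
  values of p_j and q_j at (x,y,y,x) form a binary operation table, the free "block" b_(s_j). The
  values at (x,x,u,u) at the two ends of the chain are the free tables src and tgt. With src and tgt
  the first and second projection, a chain through blocks that all are the first projection would be
  a Day sequence, hence is unsatisfiable; a single block equal to the second projection, however,
  allows the jump from the second to the third projection at that place.

  Take 2n blocks and one chain for every sequence of n distinct blocks. The assignment in which all
  blocks are the first projection is far from satisfying, but an algorithm with fewer than n queries
  misses more than n blocks, and switching those to the second projection gives a satisfying
  assignment that it cannot distinguish.
*)
theory Submission
  imports Defs
begin


section \<open>Polymorphisms and Day steps\<close>

definition pol_op :: "(nat \<times> ('a::finite) list set) set \<Rightarrow> nat \<Rightarrow> ('a list \<Rightarrow> 'a) \<Rightarrow> bool" where
  "pol_op Rels n f \<longleftrightarrow> (\<forall>(k, R) \<in> Rels. preserves n f k R)"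

text \<open>Projections and tables read off an assignment need not be \<open>undefined\<close> on
  lists of other lengths, as \<open>Pol\<close> demands. \<open>pol_op\<close> ignores such lists,
  and \<open>pol_sym\<close> normalises where an operation symbol is required.\<close>

definition pol_sym :: "nat \<Rightarrow> ('a list \<Rightarrow> 'a) \<Rightarrow> nat \<times> ('a list \<Rightarrow> 'a)" where
  "pol_sym n f = (n, \<lambda>xs. if length xs = n then f xs else undefined)"

definition day_ops :: "(nat \<times> ('a::finite) list set) set \<Rightarrow> ('a list \<Rightarrow> 'a) set" where
  "day_ops Rels = {f. pol_op Rels 4 f \<and> (\<forall>x y. f [x, y, y, x] = x)}"

text \<open>A path from the first to the fourth projection is a sequence of Day terms; the two kinds
  of agreement may occur in any order.\<close>

definition day_step :: "(nat \<times> ('a::finite) list set) set \<Rightarrow> (('a list \<Rightarrow> 'a) \<times> ('a list \<Rightarrow> 'a)) set" where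
  "day_step Rels = {(f, g). f \<in> day_ops Rels \<and> g \<in> day_ops Rels \<and>
     ((\<forall>x u. f [x, x, u, u] = g [x, x, u, u]) \<or> (\<forall>x y u. f [x, y, y, u] = g [x, y, y, u]))}"

lemma pol_op_nth:
  assumes "rel_structure Rels" "i < n"
  shows "pol_op Rels n (\<lambda>xs. xs ! i)"
proof -
  have "map (\<lambda>j. map (\<lambda>r. r ! j) rs ! i) [0..<k] \<in> R"
    if "(k, R) \<in> Rels" "length rs = n" "set rs \<subseteq> R" for k R rs
  proof -
    have "rs ! i \<in> R" using that assms by (auto simp: subset_iff)
    moreover have "length (rs ! i) = k" using assms(1) that(1) calculation
      by (auto simp: rel_structure_def)
    ultimately show ?thesis using that assms
      by (auto intro!: back_subst[of "\<lambda>x. x \<in> R", OF \<open>rs ! i \<in> R\<close>] nth_equalityI)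
  qed
  then show ?thesis by (auto simp: pol_op_def preserves_def)
qed

lemma preserves_cong:
  assumes "\<And>xs. length xs = n \<Longrightarrow> f xs = g xs"
  shows "preserves n f k R \<longleftrightarrow> preserves n g k R"
  unfolding preserves_def using assms by (auto cong: map_cong)

lemma pol_op_cong:
  assumes "\<And>xs. length xs = n \<Longrightarrow> f xs = g xs"
  shows "pol_op Rels n f \<longleftrightarrow> pol_op Rels n g"
  unfolding pol_op_def using preserves_cong[of n f g, OF assms] by (simp add: split_beta)

lemma pol_sym_in_Pol:
  assumes "pol_op Rels n f" "n \<ge> 1"
  shows "pol_sym n f \<in> Pol Rels"
proof -
  have "pol_op Rels n (\<lambda>xs. if length xs = n then f xs else undefined)"
    using assms by (subst pol_op_cong[where g = f]) auto
  then show ?thesis using assms(2) by (auto simp: pol_sym_def Pol_def pol_op_def)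
qed

section \<open>Identities in algebras of the variety\<close>

text \<open>Elements of \<open>B\<close> lift along the surjection \<open>h\<close> to tuples in the
  power, where operations act coordinatewise; thus identities of Alg(A) carry over to
  \<open>B\<close>. The list \<open>is\<close> encodes the variable pattern of a term.\<close>

lemma in_variety_eval:
  fixes B :: "('a::finite, 'b) alg" and I :: "'i set"
  assumes "in_variety Rels I B" "set as \<subseteq> fst B"
  obtains h :: "('i \<Rightarrow> 'a) \<Rightarrow> 'b" and cs where
    "as = map h cs"
    "\<And>c i. c \<in> set cs \<Longrightarrow> i \<notin> I \<Longrightarrow> c i = undefined"
    "\<And>n f is. pol_op Rels n f \<Longrightarrow> n \<ge> 1 \<Longrightarrow> length is = n \<Longrightarrow> set is \<subseteq> {..<length as} \<Longrightarrow>
       snd B (pol_sym n f) (map ((!) as) is) =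
         h (\<lambda>i. if i \<in> I then f (map ((!) (map (\<lambda>c. c i) cs)) is) else undefined)"
proof -
  obtain C and h :: "('i \<Rightarrow> 'a) \<Rightarrow> 'b" where C: "subuniverse Rels C (power_alg I)"
    and h: "surj_hom Rels h C (power_alg I) B"
    using assms by (auto simp: in_variety_def)
  have "as \<in> lists (h ` C)" using assms(2) h by (auto simp: surj_hom_def)
  then obtain cs where cs: "as = map h cs" "set cs \<subseteq> C"
    by (auto simp: lists_image)
  show ?thesis
  proof (rule that[of h cs])
    show "as = map h cs" by fact
    show "c i = undefined" if "c \<in> set cs" "i \<notin> I" for c i
      using that C cs(2) by (auto simp: subuniverse_def power_alg_def)
    fix n f "is"
    assume f: "pol_op Rels n f" "n \<ge> 1" "length is = n" "set is \<subseteq> {..<length as}"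
    have ks: "set (map ((!) cs) is) \<subseteq> C" "map ((!) as) is = map h (map ((!) cs) is)"
      "map (\<lambda>c. c i) (map ((!) cs) is) = map ((!) (map (\<lambda>c. c i) cs)) is" for i
      using f(4) cs by (auto simp: subset_iff)
    have "snd B (pol_sym n f) (map h (map ((!) cs) is))
        = h (snd (power_alg I) (pol_sym n f) (map ((!) cs) is))"
      using h pol_sym_in_Pol[OF f(1,2)] ks(1) f(3) by (auto simp: surj_hom_def pol_sym_def)
    also have "snd (power_alg I) (pol_sym n f) (map ((!) cs) is) =
        (\<lambda>i. if i \<in> I then f (map ((!) (map (\<lambda>c. c i) cs)) is) else undefined)"
      using f(3) unfolding power_alg_def pol_sym_def snd_conv ks(3) by (auto simp: fun_eq_iff)
    finally show "snd B (pol_sym n f) (map ((!) as) is) =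
         h (\<lambda>i. if i \<in> I then f (map ((!) (map (\<lambda>c. c i) cs)) is) else undefined)"
      unfolding ks(2) .
  qed
qed

lemma in_variety_identity:
  fixes B :: "('a::finite, 'b) alg" and I :: "'i set"
  assumes "in_variety Rels I B" "pol_op Rels n f" "pol_op Rels n g" "n \<ge> 1"
    and "length is = n" "set is \<subseteq> {..<length as}" "set as \<subseteq> fst B"
    and "\<And>bs :: 'a list. length bs = length as \<Longrightarrow> f (map ((!) bs) is) = g (map ((!) bs) is)"
  shows "snd B (pol_sym n f) (map ((!) as) is) = snd B (pol_sym n g) (map ((!) as) is)"
proof (rule in_variety_eval[OF assms(1,7)])
  fix h :: "('i \<Rightarrow> 'a) \<Rightarrow> 'b" and cs
  assume "as = map h cs" and eval: "\<And>n f is. pol_op Rels n f \<Longrightarrow> n \<ge> 1 \<Longrightarrow> length is = n \<Longrightarrow>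
      set is \<subseteq> {..<length as} \<Longrightarrow> snd B (pol_sym n f) (map ((!) as) is) =
         h (\<lambda>i. if i \<in> I then f (map ((!) (map (\<lambda>c. c i) cs)) is) else undefined)"
  then have "f (map ((!) (map (\<lambda>c. c i) cs)) is) = g (map ((!) (map (\<lambda>c. c i) cs)) is)" for i
    using assms(8)[of "map (\<lambda>c. c i) cs"] by simp
  then show ?thesis
    unfolding eval[OF assms(2,4,5,6)] eval[OF assms(3,4,5,6)] by (simp only:)
qed

lemma in_variety_projection:
  fixes B :: "('a::finite, 'b) alg" and I :: "'i set"
  assumes "in_variety Rels I B" "pol_op Rels n f" "n \<ge> 1"
    and "length is = n" "set is \<subseteq> {..<length as}" "set as \<subseteq> fst B" "k < length as"
    and "\<And>bs :: 'a list. length bs = length as \<Longrightarrow> f (map ((!) bs) is) = bs ! k"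
  shows "snd B (pol_sym n f) (map ((!) as) is) = as ! k"
proof (rule in_variety_eval[OF assms(1,6)])
  fix h :: "('i \<Rightarrow> 'a) \<Rightarrow> 'b" and cs
  assume as: "as = map h cs" and undef: "\<And>c i. c \<in> set cs \<Longrightarrow> i \<notin> I \<Longrightarrow> c i = undefined"
    and eval: "\<And>n f is. pol_op Rels n f \<Longrightarrow> n \<ge> 1 \<Longrightarrow> length is = n \<Longrightarrow>
      set is \<subseteq> {..<length as} \<Longrightarrow> snd B (pol_sym n f) (map ((!) as) is) =
         h (\<lambda>i. if i \<in> I then f (map ((!) (map (\<lambda>c. c i) cs)) is) else undefined)"
  have "f (map ((!) (map (\<lambda>c. c i) cs)) is) = (cs ! k) i" for i
    using assms(7) assms(8)[of "map (\<lambda>c. c i) cs"] as by simp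
  \<comment> \<open>Outside \<open>I\<close> both sides are \<open>undefined\<close>, so
    coordinatewise equality gives equality of functions.\<close>
  then have "(\<lambda>i. if i \<in> I then f (map ((!) (map (\<lambda>c. c i) cs)) is) else undefined) = cs ! k"
    using undef[of "cs ! k"] assms(7) as by auto
  then show ?thesis
    unfolding eval[OF assms(2,3,4,5)] using as assms(7) by simp
qed

section \<open>Tolerances and their compositions\<close>

definition compat :: "(nat \<times> ('a::finite) list set) set \<Rightarrow> ('a, 'b) alg \<Rightarrow> ('b \<times> 'b) set \<Rightarrow> bool" where
  "compat Rels B \<theta> \<longleftrightarrow>
     (\<forall>s \<in> Pol Rels. \<forall>xs ys. length xs = fst s \<longrightarrow> length ys = fst s \<longrightarrow>
        set xs \<subseteq> fst B \<longrightarrow> set ys \<subseteq> fst B \<longrightarrow> list_all2 (\<lambda>x y. (x, y) \<in> \<theta>) xs ys \<longrightarrow>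
        (snd B s xs, snd B s ys) \<in> \<theta>)"

text \<open>Finite alternating compositions of congruences need not be transitive, yet Day's
  argument is applied to them; hence compatibility is kept apart from transitivity.\<close>

definition tolerance :: "(nat \<times> ('a::finite) list set) set \<Rightarrow> ('a, 'b) alg \<Rightarrow> ('b \<times> 'b) set \<Rightarrow> bool" where
  "tolerance Rels B \<theta> \<longleftrightarrow> \<theta> \<subseteq> fst B \<times> fst B \<and> refl_on (fst B) \<theta> \<and> sym \<theta> \<and> compat Rels B \<theta>"

lemma congruence_iff_tolerance: "congruence Rels B \<theta> \<longleftrightarrow> tolerance Rels B \<theta> \<and> trans \<theta>"
  by (auto simp: congruence_def tolerance_def compat_def equiv_def)

lemma compat_relcomp:
  assumes "compat Rels B \<rho>" "compat Rels B \<sigma>" "\<rho> \<subseteq> fst B \<times> fst B"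
  shows "compat Rels B (\<rho> O \<sigma>)"
  unfolding compat_def
proof (intro ballI allI impI)
  fix s xs ys
  assume s: "s \<in> Pol Rels" "length xs = fst s" "length ys = fst s" "set xs \<subseteq> fst B" "set ys \<subseteq> fst B"
    and l: "list_all2 (\<lambda>x y. (x, y) \<in> \<rho> O \<sigma>) xs ys"
  \<comment> \<open>Middle elements are chosen entry by entry; the operation applied to their list
    witnesses the composition.\<close>
  from l have "\<exists>zs. list_all2 (\<lambda>x y. (x, y) \<in> \<rho>) xs zs \<and> list_all2 (\<lambda>x y. (x, y) \<in> \<sigma>) zs ys"
  proof (induction rule: list_all2_induct)
    case (Cons x xs y ys)
    then obtain zs z where "list_all2 (\<lambda>x y. (x, y) \<in> \<rho>) xs zs \<and> list_all2 (\<lambda>x y. (x, y) \<in> \<sigma>) zs ys"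
      "(x, z) \<in> \<rho>" "(z, y) \<in> \<sigma>" by auto
    then show ?case by (intro exI[of _ "z # zs"]) auto
  qed auto
  then obtain zs where zs: "list_all2 (\<lambda>x y. (x, y) \<in> \<rho>) xs zs" "list_all2 (\<lambda>x y. (x, y) \<in> \<sigma>) zs ys"
    by auto
  have "set zs \<subseteq> fst B"
    using zs(1) assms(3) by (fastforce simp: list_all2_conv_all_nth in_set_conv_nth)
  moreover have "length zs = fst s" using zs(1) s(2) list_all2_lengthD by fastforce
  ultimately have "(snd B s xs, snd B s zs) \<in> \<rho>" "(snd B s zs, snd B s ys) \<in> \<sigma>"
    using s zs assms(1,2) by (simp_all add: compat_def)
  then show "(snd B s xs, snd B s ys) \<in> \<rho> O \<sigma>" by (rule relcompI)
qed

text \<open>The palindromic shape is what keeps the composition symmetric;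
  \<open>\<rho> O \<sigma>\<close> alone need not be.\<close>

lemma tolerance_sandwich:
  assumes "tolerance Rels B \<rho>" "tolerance Rels B \<sigma>"
  shows "tolerance Rels B (\<rho> O \<sigma> O \<rho>)"
proof -
  have "compat Rels B (\<rho> O \<sigma> O \<rho>)"
    using assms by (intro compat_relcomp) (auto simp: tolerance_def)
  moreover have "sym (\<rho> O \<sigma> O \<rho>)"
    using assms by (simp add: tolerance_def sym_conv_converse_eq converse_relcomp O_assoc)
  moreover have "refl_on (fst B) (\<rho> O \<sigma> O \<rho>)"
    using assms by (auto simp: tolerance_def refl_on_def intro!: relcomp.intros)
  moreover have "\<rho> O \<sigma> O \<rho> \<subseteq> fst B \<times> fst B"
    using assms by (auto simp: tolerance_def)
  ultimately show ?thesis by (simp add: tolerance_def)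
qed

lemma tolerance_pol4:
  assumes "tolerance Rels B \<theta>" "pol_op Rels 4 f"
    and "(a, a') \<in> \<theta>" "(b, b') \<in> \<theta>" "(c, c') \<in> \<theta>" "(d, d') \<in> \<theta>"
  shows "(snd B (pol_sym 4 f) [a, b, c, d], snd B (pol_sym 4 f) [a', b', c', d']) \<in> \<theta>"
proof -
  have sub: "\<theta> \<subseteq> fst B \<times> fst B" and c: "compat Rels B \<theta>"
    using assms(1) by (auto simp: tolerance_def)
  have "pol_sym 4 f \<in> Pol Rels" using assms(2) by (simp add: pol_sym_in_Pol)
  then show ?thesis
    using c[unfolded compat_def, rule_format, of "pol_sym 4 f" "[a, b, c, d]" "[a', b', c', d']"]
      subsetD[OF sub assms(3)] subsetD[OF sub assms(4)] subsetD[OF sub assms(5)]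
      subsetD[OF sub assms(6)] assms(3-6)
    by (simp add: pol_sym_def)
qed

section \<open>Day terms imply congruence modularity\<close>

text \<open>Day's argument: each \<open>m f = f(a, b, c, d)\<close> is \<open>\<gamma>\<close>-related to \<open>a\<close>, so a step agreeing on
 \<open>(x, x, u, u)\<close> moves inside \<open>\<rho> \<inter> \<gamma>\<close> through \<open>f(a, a, d, d)\<close>, and a step agreeing on
 \<open>(x, y, y, u)\<close> moves inside \<open>\<alpha>\<close> through \<open>f(a, b, b, d)\<close>.\<close>
lemma day_sandwich:
  fixes B :: "('a::finite, 'b) alg"
  assumes V: "in_variety Rels I B" and R: "rel_structure Rels"
    and path: "((\<lambda>xs. xs ! 0), (\<lambda>xs. xs ! 3)) \<in> (day_step Rels)\<^sup>*"
    and \<rho>: "tolerance Rels B \<rho>" and \<alpha>: "congruence Rels B \<alpha>" and \<gamma>: "congruence Rels B \<gamma>"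
    and \<delta>: "congruence Rels B \<delta>" and "\<alpha> \<subseteq> \<gamma>" "\<alpha> \<subseteq> \<delta>" "\<rho> \<inter> \<gamma> \<subseteq> \<delta>"
  shows "(\<rho> O \<alpha> O \<rho>) \<inter> \<gamma> \<subseteq> \<delta>"
proof (rule subrelI)
  fix a d assume "(a, d) \<in> (\<rho> O \<alpha> O \<rho>) \<inter> \<gamma>"
  then obtain b c where bc: "(a, b) \<in> \<rho>" "(b, c) \<in> \<alpha>" "(c, d) \<in> \<rho>" and ad: "(a, d) \<in> \<gamma>" by blast
  have tol: "tolerance Rels B \<alpha>" "tolerance Rels B \<gamma>" "tolerance Rels B \<delta>"
    and tr: "trans \<alpha>" "trans \<gamma>" "trans \<delta>"
    using \<alpha> \<gamma> \<delta> by (auto simp: congruence_iff_tolerance)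
  have sy: "sym \<alpha>" "sym \<gamma>" "sym \<delta>" "sym \<rho>"
    using tol \<rho> by (auto simp: tolerance_def)
  have mem: "a \<in> fst B" "b \<in> fst B" "c \<in> fst B" "d \<in> fst B"
    using bc \<rho> by (auto simp: tolerance_def)
  have rf: "(x, x) \<in> \<alpha>" "(x, x) \<in> \<gamma>" "(x, x) \<in> \<rho>" if "x \<in> fst B" for x
    using that tol \<rho> by (auto simp: tolerance_def refl_on_def)
  have bc': "(b, a) \<in> \<rho>" "(c, b) \<in> \<alpha>" "(c, b) \<in> \<gamma>" "(d, a) \<in> \<gamma>"
    using symD[OF sy(4) bc(1)] symD[OF sy(1) bc(2)] symD[OF sy(2) ad] \<open>\<alpha> \<subseteq> \<gamma>\<close> by auto
  define m where "m f p q r s = snd B (pol_sym 4 f) [p, q, r, s]" for f p q r s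
  have idem: "m f p q q p = p" if "f \<in> day_ops Rels" "p \<in> fst B" "q \<in> fst B" for f p q
    using in_variety_projection[OF V, of 4 f "[0,1,1,0]" "[p,q]" 0] that
    by (auto simp: day_ops_def m_def)
  have m\<gamma>: "(m f a b c d, a) \<in> \<gamma>" "(m f a a d d, a) \<in> \<gamma>" and m\<rho>: "(m f a b c d, m f a a d d) \<in> \<rho>"
    and m\<alpha>: "(m f a b c d, m f a b b d) \<in> \<alpha>"
    if f: "f \<in> day_ops Rels" for f
  proof -
    have p: "pol_op Rels 4 f" using f by (simp add: day_ops_def)
    \<comment> \<open>Replacing c by b and d by a inside \<gamma> leads to f(a, b, b, a) = a;
      replacing d by a leads from f(a, a, d, d) to f(a, a, a, a) = a.\<close>
    have "(m f a b c d, m f a b b a) \<in> \<gamma>" "(m f a a d d, m f a a a a) \<in> \<gamma>"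
      unfolding m_def using mem bc' by (auto intro!: tolerance_pol4[OF tol(2) p] rf)
    then show "(m f a b c d, a) \<in> \<gamma>" "(m f a a d d, a) \<in> \<gamma>" using idem[OF f] mem by simp_all
    show "(m f a b c d, m f a a d d) \<in> \<rho>"
      unfolding m_def using mem bc bc' by (auto intro!: tolerance_pol4[OF \<rho> p] rf)
    show "(m f a b c d, m f a b b d) \<in> \<alpha>"
      unfolding m_def using mem bc' by (auto intro!: tolerance_pol4[OF tol(1) p] rf)
  qed
  have m\<delta>: "(m f a b c d, m f a a d d) \<in> \<delta>" if f: "f \<in> day_ops Rels" for f
  proof -
    have "(m f a b c d, m f a a d d) \<in> \<gamma>"
      using m\<gamma>(1)[OF f] symD[OF sy(2) m\<gamma>(2)[OF f]] by (rule transD[OF tr(2)])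
    then show ?thesis using m\<rho>[OF f] assms(10) by blast
  qed
  have day: "(m f a b c d, m g a b c d) \<in> \<delta>" if fgs: "(f, g) \<in> day_step Rels" for f g
  proof -
    have fg: "f \<in> day_ops Rels" "g \<in> day_ops Rels" using fgs by (auto simp: day_step_def)
    then have p: "pol_op Rels 4 f" "pol_op Rels 4 g" by (auto simp: day_ops_def)
    consider "\<forall>x u. f [x, x, u, u] = g [x, x, u, u]" | "\<forall>x y u. f [x, y, y, u] = g [x, y, y, u]"
      using fgs by (auto simp: day_step_def)
    then show ?thesis
    proof cases
      case 1
      have "m f a a d d = m g a a d d"
        using in_variety_identity[OF V p, of "[0,0,1,1]" "[a,d]"] 1 mem
        by (auto simp: m_def)
      then show ?thesis using m\<delta>[OF fg(1)] symD[OF sy(3) m\<delta>[OF fg(2)]] transD[OF tr(3)] by simp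
    next
      case 2
      have "m f a b b d = m g a b b d"
        using in_variety_identity[OF V p, of "[0,1,1,2]" "[a,b,d]"] 2 mem
        by (auto simp: m_def)
      then have "(m f a b c d, m g a b c d) \<in> \<alpha>"
        using m\<alpha>[OF fg(1)] symD[OF sy(1) m\<alpha>[OF fg(2)]] transD[OF tr(1)] by simp
      then show ?thesis using \<open>\<alpha> \<subseteq> \<delta>\<close> by auto
    qed
  qed
  have pr: "m (\<lambda>xs. xs ! i) a b c d = [a,b,c,d] ! i" if i: "i \<in> {0, 3}" for i
  proof -
    have "i < 4" using i by auto
    then show ?thesis
      using in_variety_projection[OF V pol_op_nth[OF R], of i 4 "[0,1,2,3]" "[a,b,c,d]" i] i mem
      by (auto simp: m_def)
  qed
  have "(m (\<lambda>xs. xs ! 0) a b c d, m g a b c d) \<in> \<delta>" if "((\<lambda>xs. xs ! 0), g) \<in> (day_step Rels)\<^sup>*" for g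
    using that
  proof (induction rule: rtrancl_induct)
    case base
    show ?case using mem tol(3) pr[of 0] by (auto simp: tolerance_def refl_on_def)
  next
    case (step f g)
    then show ?case using day transD[OF tr(3)] by blast
  qed
  from this[OF path] show "(a, d) \<in> \<delta>"
    by (simp only: pr[of 0, simplified] pr[of 3, simplified])
qed

text \<open>The union over \<open>k\<close> will bound the join from above. Each stage has the form
  \<open>\<rho> O \<alpha> O \<rho>\<close> with \<rho> the stage before, so
  \<open>day_sandwich\<close> serves as induction step.\<close>

primrec alternations :: "('b \<times> 'b) set \<Rightarrow> ('b \<times> 'b) set \<Rightarrow> nat \<Rightarrow> ('b \<times> 'b) set" where
  "alternations \<alpha> \<beta> 0 = \<beta>"
| "alternations \<alpha> \<beta> (Suc k) = alternations \<alpha> \<beta> k O \<alpha> O alternations \<alpha> \<beta> k"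

lemma tolerance_alternations:
  assumes "tolerance Rels B \<alpha>" "tolerance Rels B \<beta>"
  shows "tolerance Rels B (alternations \<alpha> \<beta> k)"
  using assms by (induction k) (auto intro: tolerance_sandwich)

lemma relcomp_alternations:
  assumes "tolerance Rels B \<alpha>" "tolerance Rels B \<beta>"
  shows "alternations \<alpha> \<beta> k O alternations \<alpha> \<beta> k \<subseteq> alternations \<alpha> \<beta> (Suc k)"
proof (rule subrelI)
  fix x z assume "(x, z) \<in> alternations \<alpha> \<beta> k O alternations \<alpha> \<beta> k"
  then obtain y where y: "(x, y) \<in> alternations \<alpha> \<beta> k" "(y, z) \<in> alternations \<alpha> \<beta> k" by auto
  then have "y \<in> fst B"
    using tolerance_alternations[OF assms, of k] by (auto simp: tolerance_def)
  then have "(y, y) \<in> \<alpha>" using assms(1) by (simp add: tolerance_def refl_on_def)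
  with y show "(x, z) \<in> alternations \<alpha> \<beta> (Suc k)" by auto
qed

lemma alternations_mono:
  assumes "tolerance Rels B \<alpha>" "tolerance Rels B \<beta>" "k \<le> l"
  shows "alternations \<alpha> \<beta> k \<subseteq> alternations \<alpha> \<beta> l"
proof -
  have "alternations \<alpha> \<beta> i \<subseteq> alternations \<alpha> \<beta> (Suc i)" for i
  proof (rule subrelI)
    fix x y assume xy: "(x, y) \<in> alternations \<alpha> \<beta> i"
    then have "(y, y) \<in> alternations \<alpha> \<beta> i"
      using tolerance_alternations[OF assms(1,2), of i] by (auto simp: tolerance_def refl_on_def)
    with xy show "(x, y) \<in> alternations \<alpha> \<beta> (Suc i)"
      using relcomp_alternations[OF assms(1,2), of i] by blast
  qed
  then show ?thesis using assms(3) by (rule lift_Suc_mono_le)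
qed

text \<open>The stages increase, so finitely many pairs lie in a common one. This gives
  compatibility, and transitivity because a stage composed with itself lies in the next.\<close>

lemma congruence_alternations:
  assumes "tolerance Rels B \<alpha>" "tolerance Rels B \<beta>"
  shows "congruence Rels B (\<Union>k. alternations \<alpha> \<beta> k)"
proof -
  let ?A = "alternations \<alpha> \<beta>"
  note tol = tolerance_alternations[OF assms]
  have "trans (\<Union>k. ?A k)"
  proof (rule transI)
    fix x y z assume "(x, y) \<in> (\<Union>k. ?A k)" "(y, z) \<in> (\<Union>k. ?A k)"
    then obtain k l where "(x, y) \<in> ?A k" "(y, z) \<in> ?A l" by auto
    then have "(x, y) \<in> ?A (max k l)" "(y, z) \<in> ?A (max k l)"
      using alternations_mono[OF assms, of k "max k l"] alternations_mono[OF assms, of l "max k l"]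
      by auto
    then show "(x, z) \<in> (\<Union>k. ?A k)" using relcomp_alternations[OF assms] by blast
  qed
  moreover have "compat Rels B (\<Union>k. ?A k)"
    unfolding compat_def
  proof (intro ballI allI impI)
    fix s xs ys
    assume s: "s \<in> Pol Rels" "length xs = fst s" "length ys = fst s" "set xs \<subseteq> fst B" "set ys \<subseteq> fst B"
      and l: "list_all2 (\<lambda>x y. (x, y) \<in> (\<Union>k. ?A k)) xs ys"
    from l have "\<exists>k. list_all2 (\<lambda>x y. (x, y) \<in> ?A k) xs ys"
    proof (induction rule: list_all2_induct)
      case (Cons x xs y ys)
      then obtain k l where "list_all2 (\<lambda>x y. (x, y) \<in> ?A k) xs ys" "(x, y) \<in> ?A l" by auto
      moreover have "?A k \<subseteq> ?A (max k l)" "?A l \<subseteq> ?A (max k l)"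
        by (simp_all add: alternations_mono[OF assms])
      ultimately have "list_all2 (\<lambda>x y. (x, y) \<in> ?A (max k l)) xs ys" "(x, y) \<in> ?A (max k l)"
        by (auto elim!: list_all2_mono)
      then show ?case by auto
    qed auto
    then obtain k where "list_all2 (\<lambda>x y. (x, y) \<in> ?A k) xs ys" by auto
    moreover have "compat Rels B (?A k)" using tol by (simp add: tolerance_def)
    ultimately have "(snd B s xs, snd B s ys) \<in> ?A k"
      using s by (simp add: compat_def)
    then show "(snd B s xs, snd B s ys) \<in> (\<Union>k. ?A k)" by blast
  qed
  moreover have "(\<Union>k. ?A k) \<subseteq> fst B \<times> fst B" using tol by (simp add: tolerance_def UN_least)
  moreover have "refl_on (fst B) (\<Union>k. ?A k)" using tol by (auto simp: tolerance_def refl_on_def)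
  moreover have "sym (\<Union>k. ?A k)" using tol by (auto simp: tolerance_def intro!: sym_UNION)
  ultimately show ?thesis by (simp add: congruence_iff_tolerance tolerance_def)
qed

text \<open>Induction over the stages puts the join of \<alpha> and \<beta>, cut with \<gamma>,
  below every congruence above \<alpha> and \<open>\<beta> \<inter> \<gamma>\<close>. The
  contrapositive turns one nonmodular algebra into the absence of a Day sequence.\<close>

lemma day_path_imp_con_modular:
  fixes B :: "('a::finite, 'b) alg"
  assumes V: "in_variety Rels I B" and R: "rel_structure Rels"
    and path: "((\<lambda>xs. xs ! 0), (\<lambda>xs. xs ! 3)) \<in> (day_step Rels)\<^sup>*"
  shows "con_modular Rels B"
  unfolding con_modular_def
proof (intro allI impI)
  fix \<alpha> \<beta> \<gamma>
  assume c: "congruence Rels B \<alpha>" "congruence Rels B \<beta>" "congruence Rels B \<gamma>" and sub: "\<alpha> \<subseteq> \<gamma>"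
  then have tol: "tolerance Rels B \<alpha>" "tolerance Rels B \<beta>" by (auto simp: congruence_iff_tolerance)
  let ?A = "alternations \<alpha> \<beta>"
  have bound: "(\<Union>k. ?A k) \<inter> \<gamma> \<subseteq> \<delta>" if \<delta>: "congruence Rels B \<delta>" "\<alpha> \<union> \<beta> \<inter> \<gamma> \<subseteq> \<delta>" for \<delta>
  proof -
    have "?A k \<inter> \<gamma> \<subseteq> \<delta>" for k
    proof (induction k)
      case 0
      show ?case using \<delta>(2) by simp
    next
      case (Suc k)
      then show ?case
        using day_sandwich[OF V R path tolerance_alternations[OF tol] c(1,3) \<delta>(1) sub] \<delta>(2) by simp
    qed
    then show ?thesis by blast
  qed
  have join: "con_join Rels B \<alpha> \<beta> \<subseteq> (\<Union>k. ?A k)"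
  proof -
    have "\<alpha> \<subseteq> ?A 1"
    proof (rule subrelI)
      fix x y assume "(x, y) \<in> \<alpha>"
      moreover from this have "(x, x) \<in> \<beta>" "(y, y) \<in> \<beta>"
        using tol by (auto simp: tolerance_def refl_on_def)
      ultimately show "(x, y) \<in> ?A 1" by auto
    qed
    moreover have "\<beta> \<subseteq> ?A 0" by simp
    ultimately have "\<alpha> \<union> \<beta> \<subseteq> (\<Union>k. ?A k)" by blast
    then show ?thesis
      unfolding con_join_def by (intro Inter_lower CollectI conjI congruence_alternations[OF tol])
  qed
  have "con_join Rels B \<alpha> \<beta> \<inter> \<gamma> \<subseteq> con_join Rels B \<alpha> (\<beta> \<inter> \<gamma>)"
    unfolding con_join_def[of _ _ _ "\<beta> \<inter> \<gamma>"]
  proof (rule Inter_greatest)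
    fix \<delta> assume "\<delta> \<in> {\<theta>. congruence Rels B \<theta> \<and> \<alpha> \<union> \<beta> \<inter> \<gamma> \<subseteq> \<theta>}"
    then have "(\<Union>k. ?A k) \<inter> \<gamma> \<subseteq> \<delta>" by (intro bound) auto
    with Int_mono[OF join order.refl] show "con_join Rels B \<alpha> \<beta> \<inter> \<gamma> \<subseteq> \<delta>" by (rule order.trans)
  qed
  moreover have "con_join Rels B \<alpha> (\<beta> \<inter> \<gamma>) \<subseteq> con_join Rels B \<alpha> \<beta> \<inter> \<gamma>"
  proof -
    have "con_join Rels B \<alpha> (\<beta> \<inter> \<gamma>) \<subseteq> \<gamma>"
      unfolding con_join_def using c(3) sub by (intro Inter_lower) simp
    moreover have "con_join Rels B \<alpha> (\<beta> \<inter> \<gamma>) \<subseteq> con_join Rels B \<alpha> \<beta>"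
      unfolding con_join_def by (intro Inter_anti_mono) auto
    ultimately show ?thesis by blast
  qed
  ultimately show "con_join Rels B \<alpha> (\<beta> \<inter> \<gamma>) = con_join Rels B \<alpha> \<beta> \<inter> \<gamma>" by blast
qed

section \<open>The chain instance\<close>

text \<open>\<open>Diag x\<close> stands for the table entries at \<open>(x, x)\<close> and \<open>(x, x, x, x)\<close>, which all tables of the
 instance share: \<open>Rels\<close> need not contain equality, so gluing has to be done by sharing variables.
 The constructors \<open>Blk\<close>, \<open>Src\<close>, \<open>Tgt\<close>, \<open>Link\<close> and \<open>Mid\<close> are only used off this diagonal.\<close>
datatype 'a var =
    Diag 'a | Blk nat 'a 'a | Src 'a 'a | Tgt 'a 'a
  | Link "nat list" nat 'a 'a | Mid "nat list" nat 'a 'a 'a | Aux bool "nat list" nat "'a list"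

instance var :: (countable) countable
  by countable_datatype

definition blk_var :: "nat \<Rightarrow> 'a \<Rightarrow> 'a \<Rightarrow> 'a var" where
  "blk_var i x y = (if x = y then Diag x else Blk i x y)"

text \<open>For 0 < j < n the table is shared by q_(j-1) and p_j of one chain; the end tables 0 and
  n are common to all chains.\<close>

definition link_var :: "nat \<Rightarrow> nat list \<Rightarrow> nat \<Rightarrow> 'a \<Rightarrow> 'a \<Rightarrow> 'a var" where
  "link_var n s j x u =
     (if x = u then Diag x else if j = 0 then Src x u else if j = n then Tgt x u else Link s j x u)"

text \<open>The variable for the value of \<open>p\<^sub>j\<close> (\<open>e = False\<close>) or \<open>q\<^sub>j\<close> (\<open>e = True\<close>) at the quadruple \<open>xs\<close>
 in the chain through the blocks \<open>s\<close>.\<close>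
definition node_var :: "nat \<Rightarrow> bool \<Rightarrow> nat list \<Rightarrow> nat \<Rightarrow> 'a list \<Rightarrow> 'a var" where
  "node_var n e s j xs = (let x = xs ! 0; y = xs ! 1; z = xs ! 2; u = xs ! 3 in
     if y = z \<and> x = u then blk_var (s ! j) x y
     else if x = y \<and> z = u then link_var n s (if e then Suc j else j) x u
     else if y = z then Mid s j x y u
     else Aux e s j xs)"

lemma node_var_blk: "node_var n e s j [x, y, y, x] = blk_var (s ! j) x y"
  by (simp add: node_var_def)

lemma node_var_link: "node_var n e s j [x, x, u, u] = link_var n s (if e then Suc j else j) x u"
  by (simp add: node_var_def blk_var_def link_var_def)

lemma node_var_mid: "node_var n False s j [x, y, y, u] = node_var n True s j [x, y, y, u]"
  by (auto simp: node_var_def)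

text \<open>Every set of n blocks is listed by some path, which gives farness; a set missing fewer
  than n of the 2n blocks meets every path, which gives satisfiability.\<close>

definition paths :: "nat \<Rightarrow> nat list set" where
  "paths n = {s. distinct s \<and> length s = n \<and> set s \<subseteq> {..<2 * n}}"

definition const_vars :: "('a::finite) var set" where
  "const_vars = Diag ` UNIV \<union> (\<lambda>(x, y). Src x y) ` {(x, y). x \<noteq> y} \<union> (\<lambda>(x, y). Tgt x y) ` {(x, y). x \<noteq> y}"

definition blk_vars :: "nat \<Rightarrow> ('a::finite) var set" where
  "blk_vars n = (\<lambda>(i, x, y). Blk i x y) ` ({..<2 * n} \<times> {(x, y). x \<noteq> y})"

definition node_vars :: "nat \<Rightarrow> ('a::finite) var set" where
  "node_vars n = (\<lambda>(e, s, j, xs). node_var n e s j xs) ` (UNIV \<times> paths n \<times> {..<n} \<times> {xs. length xs = 4})"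

text \<open>Changing a single variable outside the blocks must already cost a constant fraction of
  the total. The number of such variables does not depend on n, so weight 2n for each keeps the
  total linear in n.\<close>

definition var_weight :: "nat \<Rightarrow> 'a var \<Rightarrow> real" where
  "var_weight n v = (case v of Blk _ _ _ \<Rightarrow> 1 | _ \<Rightarrow> 2 * real n)"

text \<open>Each node carries the indicator instance of arity 4: four rows of a relation yield a
  constraint on the table entries at their columns, so solutions are quaternary
  polymorphisms.\<close>

definition chain_constraints ::
    "(nat \<times> ('a::finite) list set) set \<Rightarrow> nat \<Rightarrow> (nat list \<times> (nat \<times> 'a list set)) set" where
  "chain_constraints Rels n =
     {(map (\<lambda>i. to_nat (node_var n e s j (map (\<lambda>r. r ! i) rs))) [0..<k], (k, R)) | e s j k R rs.
        s \<in> paths n \<and> j < n \<and> (k, R) \<in> Rels \<and> length rs = 4 \<and> set rs \<subseteq> R}"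

text \<open>Node variables include free ones, which are removed from \<open>evars\<close> for
  disjointness. The constraints are an arbitrary enumeration of a finite set, and variables are
  coded as numbers by \<open>to_nat\<close>.\<close>

definition chain_inst :: "(nat \<times> ('a::finite) list set) set \<Rightarrow> nat \<Rightarrow> 'a csp_inst" where
  "chain_inst Rels n =
     \<lparr>fvars = to_nat ` (const_vars \<union> blk_vars n :: 'a var set),
      evars = to_nat ` (node_vars n :: 'a var set) - to_nat ` (const_vars \<union> blk_vars n :: 'a var set),
      constraints = (SOME cs. set cs = chain_constraints Rels n),
      weight = (\<lambda>v. var_weight n (from_nat v :: 'a var) / sum (var_weight n) (const_vars \<union> blk_vars n :: 'a var set))\<rparr>"

lemma finite_paths: "finite (paths n)"
  by (rule finite_subset[OF _ finite_lists_length_eq[of "{..<2 * n}" n]]) (auto simp: paths_def)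

lemma finite_vars [simp]:
  "finite (const_vars :: ('a::finite) var set)" "finite (blk_vars n :: ('a::finite) var set)"
  "finite (node_vars n :: ('a::finite) var set)"
proof -
  show "finite (const_vars :: 'a var set)" "finite (blk_vars n :: 'a var set)"
    by (auto simp: const_vars_def blk_vars_def)
  have "finite {xs :: 'a list. length xs = 4}"
    using finite_lists_length_eq[of "UNIV :: 'a set" 4] by simp
  then show "finite (node_vars n :: 'a var set)"
    unfolding node_vars_def by (intro finite_imageI finite_cartesian_product finite_paths) auto
qed

lemma finite_chain_constraints:
  fixes Rels :: "(nat \<times> ('a::finite) list set) set"
  assumes "rel_structure Rels"
  shows "finite (chain_constraints Rels n)"
proof -
  have fR: "finite R" if "(k, R) \<in> Rels" for k R
  proof (rule finite_subset)
    show "R \<subseteq> {xs. set xs \<subseteq> UNIV \<and> length xs = k}" using assms that by (auto simp: rel_structure_def)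
  qed (rule finite_lists_length_eq, simp)
  let ?F = "\<lambda>(e, s, j, (k, R), rs). (map (\<lambda>i. to_nat (node_var n e s j (map (\<lambda>r. r ! i) rs))) [0..<k], (k, R))"
  have "chain_constraints Rels n \<subseteq> ?F ` ((UNIV :: bool set) \<times> paths n \<times> {..<n} \<times>
      (SIGMA kR:Rels. {rs. set rs \<subseteq> snd kR \<and> length rs = 4}))"
    unfolding chain_constraints_def by (force simp: image_iff)
  moreover have "finite ((UNIV :: bool set) \<times> paths n \<times> {..<n} \<times>
      (SIGMA kR:Rels. {rs. set rs \<subseteq> snd kR \<and> length rs = 4}))"
    using assms fR by (intro finite_cartesian_product finite_paths finite_SigmaI finite_lists_length_eq)
      (auto simp: rel_structure_def)
  ultimately show ?thesis by (blast intro: finite_subset)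
qed

lemma set_constraints_chain_inst:
  assumes "rel_structure Rels"
  shows "set (constraints (chain_inst Rels n)) = chain_constraints Rels n"
  using someI_ex[OF finite_list[OF finite_chain_constraints[OF assms, of n]]]
  by (simp add: chain_inst_def)

lemma mem_const_vars [simp]:
  "Diag x \<in> const_vars" "Src x y \<in> const_vars \<longleftrightarrow> x \<noteq> y" "Tgt x y \<in> const_vars \<longleftrightarrow> x \<noteq> y"
  by (auto simp: const_vars_def)

lemma sum_var_weight_pos:
  assumes "n \<ge> 1"
  shows "0 < sum (var_weight n) (const_vars \<union> blk_vars n :: ('a::finite) var set)"
proof (rule sum_pos2)
  show "Diag undefined \<in> (const_vars \<union> blk_vars n :: 'a var set)" by simp
qed (use assms in \<open>auto simp: var_weight_def split: var.split\<close>)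

lemma wf_chain_inst:
  fixes Rels :: "(nat \<times> ('a::finite) list set) set"
  assumes "rel_structure Rels" "n \<ge> 1"
  shows "wf_inst Rels (chain_inst Rels n)"
proof -
  let ?V = "const_vars \<union> blk_vars n :: 'a var set"
  let ?S = "sum (var_weight n) ?V"
  have pos: "?S > 0" using assms(2) by (rule sum_var_weight_pos)
  have nn: "0 \<le> var_weight n v" for v :: "'a var" by (auto simp: var_weight_def split: var.split)
  have "(\<forall>x \<in> set xs. x \<in> to_nat ` (node_vars n :: 'a var set)) \<and> (k, R) \<in> Rels \<and> length xs = k"
    if c: "(xs, k, R) \<in> chain_constraints Rels n" for xs k R
  proof -
    obtain e s j and rs :: "'a list list"
      where "xs = map (\<lambda>i. to_nat (node_var n e s j (map (\<lambda>r. r ! i) rs))) [0..<k]"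
      "s \<in> paths n" "j < n" "(k, R) \<in> Rels" "length rs = 4"
      using c unfolding chain_constraints_def by blast
    moreover from this have "node_var n e s j (map (\<lambda>r. r ! i) rs) \<in> node_vars n" for i
      unfolding node_vars_def by (intro image_eqI[of _ _ "(e, s, j, map (\<lambda>r. r ! i) rs)"]) auto
    ultimately show ?thesis by auto
  qed
  moreover have "(\<Sum>x \<in> to_nat ` ?V. var_weight n (from_nat x :: 'a var) / ?S) = 1"
    using pos by (subst sum.reindex) (auto simp: o_def simp flip: sum_divide_distrib)
  moreover have "var_weight n v / ?S \<le> 1" if "v \<in> ?V" for v
    using pos member_le_sum[OF that, of "var_weight n"] nn by simp
  ultimately show ?thesis
    unfolding wf_inst_def set_constraints_chain_inst[OF assms(1)]
    using pos nn by (auto simp: chain_inst_def)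
qed

lemma chain_constraints_sat_iff:
  "(\<forall>(xs, (k, R)) \<in> chain_constraints Rels n. map g xs \<in> R) \<longleftrightarrow>
     (\<forall>s \<in> paths n. \<forall>j < n. \<forall>e. pol_op Rels 4 (\<lambda>xs. g (to_nat (node_var n e s j xs))))"
  (is "?L \<longleftrightarrow> ?R")
proof
  assume L: ?L
  show ?R
    unfolding pol_op_def preserves_def
  proof (clarify)
    fix s j e k R rs
    assume "s \<in> paths n" "j < n" "(k, R) \<in> Rels" "length rs = 4" "set rs \<subseteq> R"
    then have "(map (\<lambda>i. to_nat (node_var n e s j (map (\<lambda>r. r ! i) rs))) [0..<k], (k, R)) \<in> chain_constraints Rels n"
      unfolding chain_constraints_def by blast
    from bspec[OF L this] show "map (\<lambda>i. g (to_nat (node_var n e s j (map (\<lambda>r. r ! i) rs)))) [0..<k] \<in> R"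
      by (simp add: o_def)
  qed
next
  assume R: ?R
  show ?L
  proof clarify
    fix xs k R assume "(xs, k, R) \<in> chain_constraints Rels n"
    then obtain e s j rs where "xs = map (\<lambda>i. to_nat (node_var n e s j (map (\<lambda>r. r ! i) rs))) [0..<k]"
      and s: "s \<in> paths n" "j < n" "(k, R) \<in> Rels" "length rs = 4" "set rs \<subseteq> R"
      unfolding chain_constraints_def by blast
    moreover have "map (\<lambda>i. g (to_nat (node_var n e s j (map (\<lambda>r. r ! i) rs)))) [0..<k] \<in> R"
      using R s unfolding pol_op_def preserves_def by blast
    ultimately show "map g xs \<in> R" by (simp add: o_def)
  qed
qed

section \<open>From solutions to Day sequences\<close>

text \<open>Blocks equal to the first projection put all nodes into \<open>day_ops\<close>; shared
  variables make consecutive nodes Day steps, and the end tables attach the first and fourth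
  projections.\<close>

lemma day_path_of_solution:
  fixes Rels :: "(nat \<times> ('a::finite) list set) set" and G :: "'a var \<Rightarrow> 'a"
  assumes R: "rel_structure Rels" and n: "n \<ge> 1"
    and pol: "\<And>j e. j < n \<Longrightarrow> pol_op Rels 4 (\<lambda>xs. G (node_var n e s j xs))"
    and G: "\<And>x. G (Diag x) = x" "\<And>x u. x \<noteq> u \<Longrightarrow> G (Src x u) = x" "\<And>x u. x \<noteq> u \<Longrightarrow> G (Tgt x u) = u"
      "\<And>j x y. j < n \<Longrightarrow> x \<noteq> y \<Longrightarrow> G (Blk (s ! j) x y) = x"
  shows "((\<lambda>xs. xs ! 0), (\<lambda>xs. xs ! 3)) \<in> (day_step Rels)\<^sup>*"
proof -
  define p where "p e j = (\<lambda>xs. G (node_var n e s j xs))" for e j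
  have p: "p e j \<in> day_ops Rels" if "j < n" for e j
    using pol[OF that] G(1) G(4)[OF that] by (auto simp: day_ops_def p_def node_var_blk blk_var_def)
  have proj: "(\<lambda>xs. xs ! 0) \<in> day_ops Rels" "(\<lambda>xs. xs ! 3) \<in> day_ops Rels"
    using pol_op_nth[OF R] by (auto simp: day_ops_def)
  have mid: "(p False j, p True j) \<in> day_step Rels" if "j < n" for j
    using p[OF that] by (simp add: day_step_def p_def node_var_mid)
  have "((\<lambda>xs. xs ! 0), p True j) \<in> (day_step Rels)\<^sup>*" if "j < n" for j
    using that
  proof (induction j)
    case 0
    have "((\<lambda>xs. xs ! 0), p False 0) \<in> day_step Rels"
      using p[OF 0] proj G by (auto simp: day_step_def p_def node_var_link link_var_def)
    with mid[OF 0] show ?case by (meson r_into_rtrancl rtrancl.rtrancl_into_rtrancl)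
  next
    case (Suc j)
    then have "(p True j, p False (Suc j)) \<in> day_step Rels"
      using p by (auto simp: day_step_def p_def node_var_link)
    with mid[OF Suc.prems] Suc show ?case by (meson Suc_lessD rtrancl.rtrancl_into_rtrancl)
  qed
  from this[of "n - 1"] have "((\<lambda>xs. xs ! 0), p True (n - 1)) \<in> (day_step Rels)\<^sup>*" using n by simp
  moreover have "(p True (n - 1), (\<lambda>xs. xs ! 3)) \<in> day_step Rels"
    using p proj G n by (auto simp: day_step_def p_def node_var_link link_var_def)
  ultimately show ?thesis by (rule rtrancl.rtrancl_into_rtrancl)
qed

section \<open>Solutions after switching blocks\<close>

definition pivot :: "nat set \<Rightarrow> nat list \<Rightarrow> nat" where
  "pivot Z s = (LEAST k. k < length s \<and> s ! k \<in> Z)"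

text \<open>The index of the projection that solves node \<open>(j, e)\<close> of the chain \<open>s\<close> when the blocks in \<open>Z\<close>
 are switched to the second projection.\<close>
primrec pivot_val :: "nat set \<Rightarrow> nat list \<Rightarrow> nat \<Rightarrow> bool \<Rightarrow> nat" where
  "pivot_val Z s j False = (if j \<le> pivot Z s then if s ! j \<in> Z then 1 else 0 else if s ! j \<in> Z then 2 else 3)"
| "pivot_val Z s j True = (if j < pivot Z s then if s ! j \<in> Z then 1 else 0 else if s ! j \<in> Z then 2 else 3)"

primrec flip_val :: "nat set \<Rightarrow> 'a var \<Rightarrow> 'a" where
  "flip_val Z (Diag x) = x"
| "flip_val Z (Blk i x y) = (if i \<in> Z then y else x)"
| "flip_val Z (Src x u) = x"
| "flip_val Z (Tgt x u) = u"
| "flip_val Z (Link s j x u) = (if j \<le> pivot Z s then x else u)"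
| "flip_val Z (Mid s j x y u) = (if s ! j \<in> Z then y else if j < pivot Z s then x else u)"
| "flip_val Z (Aux e s j xs) = xs ! pivot_val Z s j e"

text \<open>At (x, x, u, u) the first two projections give x and the last two give u; at (x, y, y,
  x) the middle two give y and the outer two give x. The side of the pivot thus fixes the half, and
  the block fixes the choice within it.\<close>

lemma flip_val_node_var:
  assumes "length s = n" "j < n" "\<exists>k<n. s ! k \<in> Z" "length xs = 4"
  shows "flip_val Z (node_var n e s j xs) = xs ! pivot_val Z s j e"
proof -
  have pv: "pivot Z s < n" "s ! pivot Z s \<in> Z"
    using LeastI_ex[of "\<lambda>k. k < length s \<and> s ! k \<in> Z"] assms by (auto simp: pivot_def)
  obtain x y z u where xs: "xs = [x, y, z, u]"
    using assms(4) by (auto simp: numeral_eq_Suc length_Suc_conv)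
  \<comment> \<open>Only here do p_j and q_j lie in different halves; being the second and third
    projection, they still agree at (x, y, y, u).\<close>
  have "j = pivot Z s \<Longrightarrow> s ! j \<in> Z" using pv by simp
  then show ?thesis
    using assms(2) pv(1) by (cases e) (auto simp: xs node_var_def blk_var_def link_var_def Let_def)
qed

lemma satisfying_flip_val:
  fixes Rels :: "(nat \<times> ('a::finite) list set) set"
  assumes R: "rel_structure Rels" and Z: "card ({..<2 * n} - Z) < n"
    and f: "\<And>v. v \<in> const_vars \<union> blk_vars n \<Longrightarrow> f (to_nat v) = flip_val Z v"
  shows "satisfying (chain_inst Rels n) f"
  unfolding satisfying_def
proof (intro exI conjI)
  let ?g = "\<lambda>v. flip_val Z (from_nat v :: 'a var)"
  show "\<forall>x\<in>fvars (chain_inst Rels n). ?g x = f x" using f by (auto simp: chain_inst_def)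
  have "pol_op Rels 4 (\<lambda>xs. ?g (to_nat (node_var n e s j xs)))" if s: "s \<in> paths n" "j < n" for s j e
  proof -
    \<comment> \<open>A path avoiding \<open>Z\<close> would consist of n distinct blocks outside
      \<open>Z\<close>.\<close>
    have "\<exists>k<n. s ! k \<in> Z"
    proof (rule ccontr)
      assume "\<not> ?thesis"
      then have "set s \<subseteq> {..<2 * n} - Z" using s by (auto simp: paths_def in_set_conv_nth)
      then have "card (set s) \<le> card ({..<2 * n} - Z)" by (intro card_mono) auto
      then show False using s Z by (simp add: paths_def distinct_card)
    qed
    then have "?g (to_nat (node_var n e s j xs)) = xs ! pivot_val Z s j e" if "length xs = 4" for xs
      using s that by (simp add: flip_val_node_var paths_def)
    moreover have "pivot_val Z s j e < 4" by (cases e) auto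
    ultimately show ?thesis
      using pol_op_nth[OF R, of "pivot_val Z s j e" 4] pol_op_cong[of 4 "\<lambda>xs. ?g (to_nat (node_var n e s j xs))"]
      by metis
  qed
  then show "\<forall>(xs, (k, R))\<in>set (constraints (chain_inst Rels n)). map ?g xs \<in> R"
    unfolding set_constraints_chain_inst[OF R] chain_constraints_sat_iff by blast
qed

section \<open>Weights and distance\<close>

lemma card_pairs_le: "card {(x :: 'a::finite, y). x \<noteq> y} \<le> CARD('a)\<^sup>2"
  using card_mono[of "UNIV :: ('a \<times> 'a) set" "{(x, y). x \<noteq> y}"]
  by (simp add: power2_eq_square del: UNIV_Times_UNIV)

lemma card_const_vars_le: "card (const_vars :: ('a::finite) var set) \<le> 3 * CARD('a)\<^sup>2"
proof -
  have "card (const_vars :: 'a var set) \<le> CARD('a) + card {(x :: 'a, y). x \<noteq> y} + card {(x :: 'a, y). x \<noteq> y}"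
    unfolding const_vars_def by (intro order.trans[OF card_Un_le] add_mono card_image_le) auto
  also have "\<dots> \<le> 3 * CARD('a)\<^sup>2"
    using card_pairs_le[where 'a = 'a] le_square[of "CARD('a)"]
    unfolding power2_eq_square by linarith
  finally show ?thesis .
qed

lemma card_blk_vars_le: "card (blk_vars n :: ('a::finite) var set) \<le> 2 * n * CARD('a)\<^sup>2"
proof -
  have "card (blk_vars n :: 'a var set) \<le> card ({..<2 * n} \<times> {(x :: 'a, y). x \<noteq> y})"
    unfolding blk_vars_def by (rule card_image_le) auto
  also have "\<dots> \<le> 2 * n * CARD('a)\<^sup>2"
    using card_pairs_le[where 'a = 'a] by (simp add: card_cartesian_product)
  finally show ?thesis .
qed

lemma var_weight_const: "v \<in> const_vars \<Longrightarrow> var_weight n v = 2 * real n"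
  by (auto simp: const_vars_def var_weight_def)

lemma var_weight_blk: "v \<in> blk_vars m \<Longrightarrow> var_weight n v = 1"
  by (auto simp: blk_vars_def var_weight_def)

text \<open>With A the domain, at most 3|A|^2 variables have weight 2n and at most 2n|A|^2 have
  weight 1.\<close>

lemma sum_var_weight_le:
  "sum (var_weight n) (const_vars \<union> blk_vars n :: ('a::finite) var set) \<le> 8 * real n * real (CARD('a)\<^sup>2)"
proof -
  have "const_vars \<inter> blk_vars n = ({} :: 'a var set)" by (auto simp: const_vars_def blk_vars_def)
  then have "sum (var_weight n) (const_vars \<union> blk_vars n :: 'a var set)
      = 2 * real n * real (card (const_vars :: 'a var set)) + real (card (blk_vars n :: 'a var set))"
    by (simp add: sum.union_disjoint var_weight_const var_weight_blk cong: sum.cong)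
  also have "\<dots> \<le> 2 * real n * real (3 * CARD('a)\<^sup>2) + real (2 * n * CARD('a)\<^sup>2)"
    by (intro add_mono mult_left_mono of_nat_mono card_const_vars_le card_blk_vars_le) auto
  finally show ?thesis by (simp add: algebra_simps)
qed

text \<open>A solution changing weight less than n would keep all of \<open>const_vars\<close> and
  at least n whole blocks; the chain through n such blocks would be a Day sequence.\<close>

lemma eps_far_chain_inst:
  fixes Rels :: "(nat \<times> ('a::finite) list set) set"
  assumes R: "rel_structure Rels" and n: "n \<ge> 1"
    and no_path: "((\<lambda>xs. xs ! 0), (\<lambda>xs. xs ! 3)) \<notin> (day_step Rels)\<^sup>*"
  shows "eps_far (chain_inst Rels n) (1 / (16 * real (CARD('a)\<^sup>2))) (\<lambda>v. flip_val {} (from_nat v :: 'a var))"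
  unfolding eps_far_def
proof (intro allI impI)
  fix g assume "satisfying (chain_inst Rels n) g"
  then obtain h where sat: "\<forall>x \<in> fvars (chain_inst Rels n). h x = g x"
    "\<forall>(xs, (k, R)) \<in> set (constraints (chain_inst Rels n)). map h xs \<in> R"
    unfolding satisfying_def by blast
  have hg: "h (to_nat v) = g (to_nat v)" if "v \<in> const_vars \<union> blk_vars n" for v :: "'a var"
    using sat(1) that by (auto simp: chain_inst_def)
  have h: "pol_op Rels 4 (\<lambda>xs. h (to_nat (node_var n e s j xs)))" if "s \<in> paths n" "j < n" for s j e
    using sat(2) that unfolding set_constraints_chain_inst[OF R] chain_constraints_sat_iff by blast
  let ?V = "const_vars \<union> blk_vars n :: 'a var set"
  define D where "D = {v \<in> ?V. flip_val {} v \<noteq> g (to_nat v)}"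
  have finD: "finite D" by (simp add: D_def)
  have w1: "1 \<le> var_weight n v" for v :: "'a var"
    using n by (auto simp: var_weight_def split: var.split)
  have "real n \<le> sum (var_weight n) D"
  proof (cases "D \<inter> const_vars = {}")
    case False
    then obtain v where v: "v \<in> D" "v \<in> const_vars" by auto
    have "var_weight n v \<le> sum (var_weight n) D"
      using v finD w1 by (intro member_le_sum) (auto intro: order.trans[OF zero_le_one])
    with v show ?thesis by (simp add: var_weight_const)
  next
    case True
    \<comment> \<open>Here \<open>D\<close> contains only block variables, so \<open>index\<close>
      reads off block numbers.\<close>
    define index where "index v = (case v of Blk i _ _ \<Rightarrow> i | _ \<Rightarrow> 0)" for v :: "'a var"
    have "n \<le> card (index ` D)"
    proof (rule ccontr)
      assume "\<not> ?thesis"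
      then have "n \<le> card ({..<2 * n} - index ` D)"
        using diff_card_le_card_Diff[of "index ` D" "{..<2 * n}"] finD by simp
      then obtain T where T: "T \<subseteq> {..<2 * n} - index ` D" "card T = n"
        using obtain_subset_with_card_n by metis
      then have "finite T" using finite_subset by blast
      then obtain s where s: "set s = T" "distinct s" using finite_distinct_list by metis
      then have sp: "s \<in> paths n" using T distinct_card[of s] by (auto simp: paths_def)
      have eq: "h (to_nat v) = flip_val {} v" if "v \<in> ?V" "v \<notin> D" for v
        using that hg by (auto simp: D_def)
      have const: "h (to_nat v) = flip_val {} v" if "v \<in> const_vars" for v
        using that True by (intro eq) auto
      have blk: "h (to_nat (Blk (s ! j) x y)) = x" if "j < n" "x \<noteq> y" for j x y
      proof -
        have "s ! j \<in> T" using that s sp nth_mem[of j s] by (simp add: paths_def)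
        then have "Blk (s ! j) x y \<in> blk_vars n" "Blk (s ! j) x y \<notin> D"
          using T that by (force simp: blk_vars_def index_def image_iff)+
        then show ?thesis using eq by simp
      qed
      have "((\<lambda>xs. xs ! 0), (\<lambda>xs. xs ! 3)) \<in> (day_step Rels)\<^sup>*"
        by (rule day_path_of_solution[OF R n, where G = "\<lambda>v. h (to_nat v)" and s = s])
          (simp_all add: h[OF sp] blk const)
      with no_path show False by simp
    qed
    also have "card (index ` D) \<le> card D" using finD by (rule card_image_le)
    finally have "real n \<le> real (card D)" by simp
    also have "\<dots> \<le> sum (var_weight n) D" using sum_bounded_below[of D 1 "var_weight n"] w1 by simp
    finally show ?thesis .
  qed
  moreover have "{x \<in> fvars (chain_inst Rels n). flip_val {} (from_nat x :: 'a var) \<noteq> g x} = to_nat ` D"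
    by (auto simp: chain_inst_def D_def)
  then have "wdist (chain_inst Rels n) (\<lambda>v. flip_val {} (from_nat v :: 'a var)) g
      = sum (var_weight n) D / sum (var_weight n) ?V"
    unfolding wdist_def by (simp add: sum.reindex chain_inst_def flip: sum_divide_distrib)
  moreover have "real n / (8 * real n * real (CARD('a)\<^sup>2)) \<le> real n / sum (var_weight n) ?V"
    using sum_var_weight_le[of n, where 'a = 'a] sum_var_weight_pos[OF n, where 'a = 'a] n
    by (intro divide_left_mono) auto
  \<comment> \<open>The bound obtained is 1/(8|A|^2); halving it gives the strict inequality in
    \<open>eps_far\<close>.\<close>
  moreover have "1 / (16 * real (CARD('a)\<^sup>2)) < real n / (8 * real n * real (CARD('a)\<^sup>2))"
    using n by (simp add: field_simps)
  moreover have "real n / sum (var_weight n) ?V \<le> sum (var_weight n) D / sum (var_weight n) ?V"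
    using calculation(1) sum_var_weight_pos[OF n, where 'a = 'a] by (simp add: divide_right_mono)
  ultimately show "1 / (16 * real (CARD('a)\<^sup>2)) < wdist (chain_inst Rels n) (\<lambda>v. flip_val {} (from_nat v :: 'a var)) g"
    by linarith
qed

section \<open>The query lower bound\<close>

primrec queried :: "('v, 'a) dtree \<Rightarrow> ('v \<Rightarrow> 'a) \<Rightarrow> 'v set" where
  "queried (Leaf b) f = {}"
| "queried (Query x t) f = insert x (queried (t (f x)) f)"

lemma finite_queried [simp]: "finite (queried t f)"
  by (induction t) auto

lemma card_queried_le: "card (queried t f) \<le> nqueries t f"
  by (induction t) (auto simp: card_insert_if intro: le_SucI)

lemma run_cong_queried:
  "(\<And>x. x \<in> queried t f \<Longrightarrow> g x = f x) \<Longrightarrow> run t g = run t f"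
  by (induction t) auto

text \<open>By one-sidedness no tree in the support rejects a satisfying assignment; with fewer than
  n queries, switching all unseen blocks would produce one with the same answers.\<close>

lemma rejecting_tree_nqueries_ge:
  fixes Rels :: "(nat \<times> ('a::finite) list set) set"
  assumes R: "rel_structure Rels" and T: "one_sided_tester Rels eps T" and n: "n \<ge> 1"
    and t: "t \<in> set_pmf (T (chain_inst Rels n))"
    and reject: "\<not> run t (\<lambda>v. flip_val {} (from_nat v :: 'a var))"
  shows "n \<le> nqueries t (\<lambda>v. flip_val {} (from_nat v :: 'a var))"
proof (rule ccontr)
  let ?f = "\<lambda>v. flip_val {} (from_nat v :: 'a var)"
  assume few: "\<not> ?thesis"
  define Z where "Z = {i. \<forall>x y :: 'a. to_nat (Blk i x y) \<notin> queried t ?f}"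
  \<comment> \<open>A query touches at most one block, so touched blocks number at most the queries;
    sending other variables to 0 can only enlarge the image.\<close>
  define index where "index v = (case from_nat v of Blk i (_ :: 'a) _ \<Rightarrow> i | _ \<Rightarrow> 0)" for v
  have "{..<2 * n} - Z \<subseteq> index ` queried t ?f"
    by (force simp: Z_def index_def image_iff)
  then have "card ({..<2 * n} - Z) \<le> card (index ` queried t ?f)"
    by (intro card_mono) auto
  also have "\<dots> \<le> card (queried t ?f)" by (intro card_image_le) simp
  also have "\<dots> < n" using few card_queried_le[of t ?f] by linarith
  finally have Z: "card ({..<2 * n} - Z) < n" .
  define g where "g v = (if v \<in> queried t ?f then ?f v else flip_val Z (from_nat v :: 'a var))" for v
  \<comment> \<open>Queried blocks lie outside \<open>Z\<close>, and on \<open>const_vars\<close>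
    the value does not depend on \<open>Z\<close>.\<close>
  have "g (to_nat v) = flip_val Z v" if "v \<in> const_vars \<union> blk_vars n" for v :: "'a var"
    using that by (auto simp: g_def Z_def const_vars_def blk_vars_def) blast+
  from satisfying_flip_val[OF R Z this] have "satisfying (chain_inst Rels n) g" by blast
  then have "measure_pmf.prob (T (chain_inst Rels n)) {t. run t g} = 1"
    using T wf_chain_inst[OF R n] by (simp add: one_sided_tester_def)
  then have "run t g" using t by (simp add: measure_pmf.prob_eq_1 AE_measure_pmf_iff)
  moreover have "run t g = run t ?f" by (rule run_cong_queried) (simp add: g_def)
  ultimately show False using reject by simp
qed

text \<open>Over one element the two projections coincide and the empty path joins them. Two
  distinct elements ensure that block variables exist, so the number of free variables grows with
  n.\<close>

lemma exists_distinct_of_no_day_path: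
  fixes Rels :: "(nat \<times> ('a::finite) list set) set"
  assumes "((\<lambda>xs. xs ! 0), (\<lambda>xs. xs ! 3)) \<notin> (day_step Rels)\<^sup>*"
  shows "\<exists>x y :: 'a. x \<noteq> y"
proof (rule ccontr)
  assume "\<not> ?thesis"
  then have "(\<lambda>xs :: 'a list. xs ! 0) = (\<lambda>xs. xs ! 3)" by auto
  with assms show False by simp
qed

lemma no_day_path_imp_linear_queries:
  fixes Rels :: "(nat \<times> ('a::finite) list set) set"
  assumes R: "rel_structure Rels"
    and no_path: "((\<lambda>xs. xs ! 0), (\<lambda>xs. xs ! 3)) \<notin> (day_step Rels)\<^sup>*"
    and T: "one_sided_tester Rels (1 / (16 * real (CARD('a)\<^sup>2))) T"
  shows "\<exists>P f. wf_inst Rels P \<and> card (fvars P) \<ge> N \<and>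
    (\<exists>t \<in> set_pmf (T P). real (nqueries t f) \<ge> 1 / (5 * real (CARD('a)\<^sup>2)) * real (card (fvars P)))"
proof -
  define n where "n = Suc N"
  then have n: "n \<ge> 1" by simp
  let ?P = "chain_inst Rels n" and ?f = "\<lambda>v. flip_val {} (from_nat v :: 'a var)"
  have wf: "wf_inst Rels ?P" using R n by (rule wf_chain_inst)
  have card_eq: "card (fvars ?P) = card (const_vars \<union> blk_vars n :: 'a var set)"
    by (simp add: chain_inst_def card_image)
  have "card (fvars ?P) \<le> 3 * CARD('a)\<^sup>2 + 2 * n * CARD('a)\<^sup>2"
    unfolding card_eq
    by (intro order.trans[OF card_Un_le] add_mono card_const_vars_le card_blk_vars_le)
  \<comment> \<open>This bound of 5n|A|^2 free variables is the source of the factor 1/5.\<close>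
  also have "\<dots> \<le> 3 * n * CARD('a)\<^sup>2 + 2 * n * CARD('a)\<^sup>2" using n by simp
  finally have upper: "card (fvars ?P) \<le> 5 * CARD('a)\<^sup>2 * n" by (simp add: algebra_simps)
  obtain x y :: 'a where "x \<noteq> y" using exists_distinct_of_no_day_path[OF no_path] by blast
  then have "(\<lambda>i. Blk i x y) ` {..<2 * n} \<subseteq> const_vars \<union> blk_vars n"
    by (force simp: blk_vars_def)
  then have "card ((\<lambda>i. Blk i x y) ` {..<2 * n}) \<le> card (fvars ?P)"
    unfolding card_eq by (intro card_mono) auto
  then have lower: "N \<le> card (fvars ?P)" by (simp add: card_image inj_on_def n_def)
  have "measure_pmf.prob (T ?P) {t. \<not> run t ?f} \<ge> 2/3"
    using T wf eps_far_chain_inst[OF R n no_path] by (simp add: one_sided_tester_def)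
  then have "measure_pmf.prob (T ?P) {t. \<not> run t ?f} \<noteq> 0" by linarith
  then obtain t where t: "t \<in> set_pmf (T ?P)" "\<not> run t ?f"
    by (auto simp: measure_pmf_zero_iff)
  have "1 / (5 * real (CARD('a)\<^sup>2)) * real (card (fvars ?P)) \<le> 1 / (5 * real (CARD('a)\<^sup>2)) * real (5 * CARD('a)\<^sup>2 * n)"
    using upper by (intro mult_left_mono) (simp_all only: of_nat_le_iff, simp)
  also have "\<dots> = real n" by simp
  also have "\<dots> \<le> real (nqueries t ?f)" using rejecting_tree_nqueries_ge[OF R T n t] by simp
  finally show ?thesis using wf lower t(1) by blast
qed

theorem mainTheorem17:
  fixes Rels :: "(nat \<times> ('a::finite) list set) set"
    and I :: "'i set"
    and B :: "('a, 'b) alg"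
  assumes "rel_structure Rels"
    and "in_variety Rels I B"
    and "\<not> con_modular Rels B"
  shows "\<exists>eps > 0. \<forall>T. one_sided_tester Rels eps T \<longrightarrow>
           (\<exists>c > 0. \<forall>N. \<exists>P f. wf_inst Rels P \<and> card (fvars P) \<ge> N \<and>
              (\<exists>t \<in> set_pmf (T P). real (nqueries t f) \<ge> c * real (card (fvars P))))"
proof -
  have no_path: "((\<lambda>xs. xs ! 0), (\<lambda>xs. xs ! 3)) \<notin> (day_step Rels)\<^sup>*"
    using day_path_imp_con_modular[OF assms(2,1)] assms(3) by blast
  show ?thesis
  proof (rule exI[of _ "1 / (16 * real (CARD('a)\<^sup>2))"], intro conjI allI impI)
    fix T assume T: "one_sided_tester Rels (1 / (16 * real (CARD('a)\<^sup>2))) T"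
    show "\<exists>c > 0. \<forall>N. \<exists>P f. wf_inst Rels P \<and> card (fvars P) \<ge> N \<and>
              (\<exists>t \<in> set_pmf (T P). real (nqueries t f) \<ge> c * real (card (fvars P)))"
      using no_day_path_imp_linear_queries[OF assms(1) no_path T]
      by (intro exI[of _ "1 / (5 * real (CARD('a)\<^sup>2))"] conjI) simp_all
  qed simp
qed

end
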